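(* Let $A\in M_n(\mathbb C)$ be normal with eigenvalues $\lambda_1,\dots,\lambda_n$ (with multiplicity), and let $u$ be a Haar-distributed unit vector in $\mathbb C^n$. Put $\bar\lambda=n^{-1}\sum_i\lambda_i$. Then \[ \mathbb E\,z_A(u)=\bar\lambda,\qquad \mathbb E|z_A(u)-\bar\lambda|^2=\frac1{n+1}\left(\frac1n\sum_i|\lambda_i-\bar\lambda|^2\right). \] In particular, if $s^2=n^{-1}\sum_i|\lambda_i-\bar\lambda|^2$, then for every $r>0$, \[ \mathbb P\{|z_A(u)-\bar\lambda|\ge r\}\le\frac{s^2}{(n+1)r^2}. \]
   Context: $z_A(u)=u^*Au$. Haar-distributed means distributed according to the unitarily invariant probability measure on the unit sphere of $\mathbb C^n$. *)

theory Defs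
  imports "HOL-Probability.Probability" "HOL-Computational_Algebra.Polynomial"
begin

definition adjoint_matrix :: "complex ^ 'n ^ 'm \<Rightarrow> complex ^ 'm ^ 'n" where
  "adjoint_matrix A = (\<chi> i j. cnj (A $ j $ i))"

definition normal_matrix :: "complex ^ 'n ^ 'n \<Rightarrow> bool" where
  "normal_matrix A \<longleftrightarrow> A ** adjoint_matrix A = adjoint_matrix A ** A"

definition unitary_matrix :: "complex ^ 'n ^ 'n \<Rightarrow> bool" where
  "unitary_matrix U \<longleftrightarrow>
     adjoint_matrix U ** U = mat 1 \<and> U ** adjoint_matrix U = mat 1"

definition charpoly :: "complex ^ 'n ^ 'n \<Rightarrow> complex poly" where
  "charpoly A = det (mat [:0, 1:] - map_matrix (\<lambda>a. [:a:]) A)"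

text \<open>The family of eigenvalues is listed with algebraic multiplicity. It is indexed by the
  type \<^typ>\<open>'n\<close> that also indexes the coordinates; the order of the listing is arbitrary.\<close>

definition eigenvalue_list :: "complex ^ 'n ^ 'n \<Rightarrow> ('n \<Rightarrow> complex) \<Rightarrow> bool" where
  "eigenvalue_list A eig \<longleftrightarrow> charpoly A = (\<Prod>i\<in>UNIV. [:- eig i, 1:])"

definition eigenvalue_mean :: "('n::finite \<Rightarrow> complex) \<Rightarrow> complex" where
  "eigenvalue_mean eig = (\<Sum>i\<in>UNIV. eig i) / of_nat CARD('n)"

text \<open>The quadratic form \<open>u\<^sup>* A u\<close>.\<close>

definition zform :: "complex ^ 'n ^ 'n \<Rightarrow> complex ^ 'n \<Rightarrow> complex" where
  "zform A u = (\<Sum>i\<in>UNIV. cnj (u $ i) * (A *v u) $ i)"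

abbreviation sphere_borel :: "(complex ^ 'n) measure" where
  "sphere_borel \<equiv> restrict_space borel (sphere 0 1)"

text \<open>A unitarily invariant Borel probability measure on the unit sphere of
  \<^typ>\<open>complex ^ 'n\<close>; by uniqueness of that measure this predicate determines \<open>\<mu>\<close>.\<close>

definition haar_sphere_measure :: "(complex ^ 'n) measure \<Rightarrow> bool" where
  "haar_sphere_measure \<mu> \<longleftrightarrow>
     prob_space \<mu> \<and> sets \<mu> = sets sphere_borel \<and>
     (\<forall>U. unitary_matrix U \<longrightarrow> distr \<mu> sphere_borel (\<lambda>x. U *v x) = \<mu>)"

definition haar_distributed :: "'a measure \<Rightarrow> ('a \<Rightarrow> complex ^ 'n) \<Rightarrow> bool" where
  "haar_distributed M u \<longleftrightarrow>
     u \<in> measurable M sphere_borel \<and> haar_sphere_measure (distr M sphere_borel u)"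

end

theory Submission
  imports Defs "HOL-Computational_Algebra.Fundamental_Theorem_Algebra"
begin

text \<open>
  Unitary invariance lets a normal matrix be replaced by a diagonal one. By the spectral theorem
  (\<open>normal_matrix_unitarily_diagonalizable\<close>) there are a unitary \<open>U\<close> and
  numbers \<open>d i\<close> with \<open>A U = U diag(d)\<close>; the vector \<open>U u\<close> has the law of \<open>u\<close>, and
  \<open>z\<^sub>A(U u) = \<Sum>i. d i * |u\<^sub>i|\<^sup>2\<close>. The characteristic polynomial is invariant under similarity,
  so the \<open>d i\<close> are the given eigenvalues up to order, which no symmetric sum can see. Everything thus
  reduces to the first two joint moments of the random probability vector \<open>(|u\<^sub>i|\<^sup>2)\<^sub>i\<close>.

  Those moments follow from invariance under unitaries acting on two coordinates, together with
  \<open>\<Sum>i. |u\<^sub>i|\<^sup>2 = 1\<close>. Exchanging coordinates gives \<open>E |u\<^sub>i|\<^sup>2 = 1/n\<close> and shows that all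
  \<open>E |u\<^sub>i|\<^sup>4\<close> are equal. The key relation \<open>E |u\<^sub>i|\<^sup>4 = 2 E |u\<^sub>i|\<^sup>2 |u\<^sub>j|\<^sup>2\<close>
  (\<open>haar_expectation_coord_product\<close>) comes from a phase change and a balanced
  mixing of two coordinates; expanding \<open>E (\<Sum>i. |u\<^sub>i|\<^sup>2)\<^sup>2 = 1\<close> then fixes the values as
  \<open>(1 + \<delta>\<^sub>i\<^sub>j) / (n (n + 1))\<close>. For weights \<open>c i = d i - mean\<close> of total \<open>0\<close>, the constant part of
  these moments contributes \<open>|\<Sum>i. c i|\<^sup>2 = 0\<close> to the variance, and the diagonal part leaves
  \<open>\<Sum>i. |c i|\<^sup>2 / (n (n + 1))\<close>. The tail bound is Chebyshev's inequality.
\<close>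

section \<open>The Hermitian inner product and unitary matrices\<close>

definition cdot :: "complex ^ 'n \<Rightarrow> complex ^ 'n \<Rightarrow> complex" where
  "cdot x y = (\<Sum>i\<in>UNIV. cnj (x $ i) * y $ i)"

lemma cdot_scale_left: "cdot (c *s x) y = cnj c * cdot x y"
  and cdot_scale_right: "cdot x (c *s y) = c * cdot x y"
  by (simp_all add: cdot_def sum_distrib_left mult_ac)

lemma cdot_add_right: "cdot x (y + z) = cdot x y + cdot x z"
  by (simp add: cdot_def ring_distribs sum.distrib)

lemma cdot_commute: "cdot y x = cnj (cdot x y)"
  by (simp add: cdot_def mult.commute)

lemma cdot_self: "cdot x x = of_real ((norm x)\<^sup>2)"
proof -
  have "cdot x x = of_real (\<Sum>i\<in>UNIV. (norm (x $ i))\<^sup>2)"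
    by (simp add: cdot_def complex_norm_square[symmetric] mult.commute)
  also have "(\<Sum>i\<in>UNIV. (norm (x $ i))\<^sup>2) = (norm x)\<^sup>2"
    by (simp add: norm_vec_def L2_set_def sum_nonneg)
  finally show ?thesis .
qed

lemma cdot_self_eq_0_iff: "cdot x x = 0 \<longleftrightarrow> x = 0"
  by (simp add: cdot_self)

lemma cdot_matrix_right: "cdot x (A *v y) = cdot (adjoint_matrix A *v x) y"
proof -
  have "cdot x (A *v y) = (\<Sum>i\<in>UNIV. \<Sum>j\<in>UNIV. cnj (x $ i) * (A $ i $ j * y $ j))"
    by (simp add: cdot_def matrix_vector_mult_def sum_distrib_left)
  also have "\<dots> = (\<Sum>j\<in>UNIV. \<Sum>i\<in>UNIV. cnj (x $ i) * (A $ i $ j * y $ j))"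
    by (rule sum.swap)
  also have "\<dots> = cdot (adjoint_matrix A *v x) y"
    by (simp add: cdot_def matrix_vector_mult_def adjoint_matrix_def sum_distrib_left sum_distrib_right mult_ac)
  finally show ?thesis .
qed

lemma adjoint_adjoint_matrix [simp]: "adjoint_matrix (adjoint_matrix A) = A"
  by (simp add: adjoint_matrix_def vec_eq_iff)

lemma cdot_matrix_left: "cdot (A *v x) y = cdot x (adjoint_matrix A *v y)"
  by (simp add: cdot_matrix_right)

lemma unitary_preserves_norm:
  assumes "unitary_matrix U"
  shows "norm (U *v x) = norm x"
proof -
  have "cdot (U *v x) (U *v x) = cdot x x"
    using assms by (simp add: cdot_matrix_left matrix_vector_mul_assoc unitary_matrix_def)
  then have "complex_of_real ((norm (U *v x))\<^sup>2) = complex_of_real ((norm x)\<^sup>2)"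
    by (simp only: cdot_self)
  then have "(norm (U *v x))\<^sup>2 = (norm x)\<^sup>2"
    by (simp only: of_real_eq_iff)
  then show ?thesis by simp
qed

lemma matrix_vector_scale: "(A :: complex ^ 'n ^ 'm) *v (c *s x) = c *s (A *v x)"
  by (simp add: vec_eq_iff matrix_vector_mult_def sum_distrib_left mult_ac)

text \<open>For a normal matrix \<open>A\<close>, the adjoint of \<open>A\<close> commutes with \<open>A\<close>, so the residual
  \<open>y = A\<^sup>* x - cnj c *s x\<close> is itself an eigenvector of \<open>A\<close> for \<open>c\<close> (or zero); pairing it with its
  own definition and moving \<open>A\<^sup>*\<close> across gives \<open>cdot y y = 0\<close>. This is what makes the
  orthogonal complement of a set of eigenvectors invariant under \<open>A\<close>.\<close>

lemma normal_adjoint_eigenvector: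
  assumes "normal_matrix A" and ev: "A *v x = c *s x"
  shows "adjoint_matrix A *v x = cnj c *s x"
proof -
  let ?B = "adjoint_matrix A"
  let ?y = "?B *v x - cnj c *s x"
  have comm: "A *v (?B *v x) = ?B *v (A *v x)"
    using assms(1) by (simp add: normal_matrix_def matrix_vector_mul_assoc)
  have "A *v ?y = c *s ?y"
    by (simp add: matrix_vector_mult_diff_distrib matrix_vector_scale comm ev
        vector_ssub_ldistrib vector_smult_assoc mult.commute)
  moreover have "cdot ?y ?y = cdot ?y (?B *v x) - cnj c * cdot ?y x"
    by (metis (no_types, lifting) cdot_add_right cdot_scale_right diff_add_cancel add_diff_cancel_right')
  moreover have "cdot ?y (?B *v x) = cdot (A *v ?y) x"
    by (simp only: cdot_matrix_left)
  ultimately have "cdot ?y ?y = 0"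
    by (simp only: cdot_scale_left diff_self)
  then show ?thesis
    by (simp add: cdot_self_eq_0_iff)
qed

section \<open>Eigenvectors in invariant subspaces\<close>

text \<open>The vector \<open>p(A) x\<close>. By Horner's scheme it is built from \<open>x\<close> with the operations under
  which an \<open>A\<close>-invariant subspace is closed, so it stays in every such subspace containing \<open>x\<close>.\<close>

definition poly_act :: "complex ^ 'n ^ 'n \<Rightarrow> complex poly \<Rightarrow> complex ^ 'n \<Rightarrow> complex ^ 'n" where
  "poly_act A p x = fold_coeffs (\<lambda>a y. a *s x + A *v y) p 0"

lemma poly_act_0 [simp]: "poly_act A 0 x = 0"
  by (simp add: poly_act_def)

lemma poly_act_pCons [simp]: "poly_act A (pCons a p) x = a *s x + A *v poly_act A p x"
  by (cases "p = 0"; cases "a = 0") (simp_all add: poly_act_def)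

lemma poly_act_add: "poly_act A (p + q) x = poly_act A p x + poly_act A q x"
  by (induction p q rule: poly_induct2)
     (simp_all add: matrix_vector_right_distrib vec.scale_left_distrib)

lemma poly_act_smult: "poly_act A (smult c p) x = c *s poly_act A p x"
  by (induction p)
     (simp_all add: matrix_vector_scale vector_add_ldistrib vector_smult_assoc)

lemma poly_act_monom: "poly_act A (monom c k) x = c *s (((*v) A ^^ k) x)"
  by (induction k) (simp_all add: monom_0 monom_Suc matrix_vector_scale)

lemma poly_act_sum: "poly_act A (\<Sum>k\<in>K. f k) x = (\<Sum>k\<in>K. poly_act A (f k) x)"
  by (induction K rule: infinite_finite_induct) (simp_all add: poly_act_add)

lemma poly_act_linear_factor:
  "poly_act A ([:- c, 1:] * q) x = A *v poly_act A q x - c *s poly_act A q x"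
proof -
  have "[:- c, 1:] * q = smult (- c) q + pCons 0 q"
    by simp
  then show ?thesis
    by (simp only: poly_act_add poly_act_smult poly_act_pCons) simp
qed

text \<open>The relation is stated for a sequence instead of a set because the terms may repeat; a
  repetition \<open>w j = w k\<close> is then a relation of its own.\<close>

lemma exists_linear_relation:
  fixes w :: "nat \<Rightarrow> 'a::euclidean_space"
  shows "\<exists>c :: nat \<Rightarrow> real. (\<exists>k\<le>DIM('a). c k \<noteq> 0) \<and> (\<Sum>k\<le>DIM('a). c k *\<^sub>R w k) = 0"
proof (cases "inj_on w {..DIM('a)}")
  case True
  then have "card (w ` {..DIM('a)}) > DIM('a)"
    by (simp add: card_image)
  then have "dependent (w ` {..DIM('a)})"
    by (intro dependent_biggerset)
  then obtain g where g: "\<exists>v\<in>w ` {..DIM('a)}. g v \<noteq> 0" "(\<Sum>v\<in>w ` {..DIM('a)}. g v *\<^sub>R v) = 0"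
    by (auto simp: dependent_finite)
  have "(\<Sum>k\<le>DIM('a). g (w k) *\<^sub>R w k) = 0"
    using g(2) True by (simp add: sum.reindex)
  with g(1) show ?thesis
    by (intro exI[of _ "\<lambda>k. g (w k)"]) auto
next
  case False
  then obtain j k where jk: "j \<le> DIM('a)" "k \<le> DIM('a)" "j \<noteq> k" "w j = w k"
    by (auto simp: inj_on_def)
  let ?c = "\<lambda>m. (if m = j then 1 else 0) - (if m = k then 1 else 0) :: real"
  have "(\<Sum>m\<le>DIM('a). ?c m *\<^sub>R w m) =
      (\<Sum>m\<le>DIM('a). if m = j then w m else 0) - (\<Sum>m\<le>DIM('a). if m = k then w m else 0)"
    unfolding sum_subtractf[symmetric] by (intro sum.cong) auto
  also have "\<dots> = 0"
    using jk by simp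
  finally show ?thesis
    using jk by (intro exI[of _ ?c]) (auto intro!: exI[of _ j])
qed

lemma exists_annihilating_poly: "\<exists>p. p \<noteq> 0 \<and> poly_act A p (x :: complex ^ 'n) = 0"
proof -
  let ?N = "DIM(complex ^ 'n)"
  obtain c :: "nat \<Rightarrow> real" where
    c: "\<exists>k\<le>?N. c k \<noteq> 0" "(\<Sum>k\<le>?N. c k *\<^sub>R (((*v) A ^^ k) x)) = 0"
    using exists_linear_relation[of "\<lambda>k. ((*v) A ^^ k) x"] by blast
  let ?p = "\<Sum>k\<le>?N. monom (of_real (c k) :: complex) k"
  have "(\<Sum>k\<le>?N. poly_act A (monom (of_real (c k)) k) x) = (\<Sum>k\<le>?N. c k *\<^sub>R (((*v) A ^^ k) x))"
    by (intro sum.cong refl) (simp add: poly_act_monom vec_eq_iff scaleR_conv_of_real[where 'a=complex])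
  then have "poly_act A ?p x = 0"
    using c(2) by (simp add: poly_act_sum)
  moreover have "?p \<noteq> 0"
  proof
    assume "?p = 0"
    then have "coeff ?p k = 0" for k by simp
    then have "c k = 0" if "k \<le> ?N" for k
      using that by (simp add: coeff_sum split: if_splits) (metis of_real_eq_0_iff)
    with c(1) show False by blast
  qed
  ultimately show ?thesis by blast
qed

text \<open>Take a nonzero polynomial \<open>p\<close> of least degree with \<open>p(A) x = 0\<close> and split off a root,
  \<open>p = (X - c) q\<close>. By minimality \<open>q(A) x\<close> is nonzero, and it is an eigenvector for \<open>c\<close>. It lies in
  every \<open>A\<close>-invariant subspace that contains \<open>x\<close>.\<close>

lemma invariant_subspace_eigenvector:
  fixes A :: "complex ^ 'n ^ 'n"
  assumes add: "\<And>x y. x \<in> W \<Longrightarrow> y \<in> W \<Longrightarrow> x + y \<in> W"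
    and scale: "\<And>c x. x \<in> W \<Longrightarrow> c *s x \<in> W"
    and inv: "\<And>x. x \<in> W \<Longrightarrow> A *v x \<in> W"
    and x: "x \<in> W" "x \<noteq> 0"
  obtains y c where "y \<in> W" "y \<noteq> 0" "A *v y = c *s y"
proof -
  have mem: "poly_act A p x \<in> W" for p
  proof (induction p)
    case 0
    show ?case using scale[OF x(1), of 0] by simp
  next
    case (pCons a p)
    then show ?case by (auto intro!: add scale inv x)
  qed
  obtain p where p: "p \<noteq> 0" "poly_act A p x = 0"
    and least: "\<And>q. q \<noteq> 0 \<Longrightarrow> poly_act A q x = 0 \<Longrightarrow> degree p \<le> degree q"
    using exists_least_iff[of "\<lambda>m. \<exists>p. p \<noteq> 0 \<and> poly_act A p x = 0 \<and> degree p = m"]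
      exists_annihilating_poly[of A x] by (metis not_le)
  have "degree p \<noteq> 0"
  proof
    assume "degree p = 0"
    then obtain a where "p = [:a:]" by (metis degree_eq_zeroE)
    with p x(2) show False by simp
  qed
  then obtain c where "poly p c = 0"
    using fundamental_theorem_of_algebra_alt[of p] by (metis degree_pCons_0)
  then obtain q where q: "p = [:- c, 1:] * q"
    by (metis dvdE poly_eq_0_iff_dvd)
  with p(1) have "q \<noteq> 0" "degree q < degree p"
    by (auto simp: degree_mult_eq simp del: mult_pCons_left)
  then have "poly_act A q x \<noteq> 0"
    using least[of q] by linarith
  moreover have "A *v poly_act A q x = c *s poly_act A q x"
    using p(2) unfolding q poly_act_linear_factor by simp
  ultimately show thesis
    using that mem by blast
qed

section \<open>The spectral theorem for normal matrices\<close>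

text \<open>The condition is a square homogeneous system whose \<open>i0\<close>-th row may be taken to be zero.\<close>

lemma exists_orthogonal_vector:
  fixes v :: "'n::finite \<Rightarrow> complex ^ 'n"
  assumes "i0 \<notin> I"
  shows "\<exists>x. x \<noteq> 0 \<and> (\<forall>i\<in>I. cdot (v i) x = 0)"
proof -
  let ?M = "(\<chi> i j. if i \<in> I then cnj (v i $ j) else 0) :: complex ^ 'n ^ 'n"
  have "row i0 ?M = 0"
    using assms by (simp add: row_def vec_eq_iff)
  then have "\<not> invertible ?M"
    by (simp add: invertible_det_nz det_zero_row)
  then obtain x where x: "?M *v x = 0" "x \<noteq> 0"
    using matrix_left_invertible_ker[of ?M] by (auto simp: invertible_left_inverse)
  have "cdot (v i) x = 0" if "i \<in> I" for i
  proof -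
    have "cdot (v i) x = (?M *v x) $ i"
      using that by (simp add: cdot_def matrix_vector_mult_def)
    with x(1) show ?thesis by simp
  qed
  with x(2) show ?thesis by blast
qed

text \<open>Induction on the index set: the orthogonal complement of the eigenvectors already found
  is nonzero as long as an index is left, and it is invariant because those vectors are also
  eigenvectors of the adjoint. It therefore contains a further eigenvector.\<close>

lemma normal_orthonormal_eigenvectors:
  fixes A :: "complex ^ 'n ^ 'n" and I :: "'n set"
  assumes "normal_matrix A"
  shows "\<exists>(v :: 'n \<Rightarrow> complex ^ 'n) d. \<forall>i\<in>I. A *v v i = d i *s v i \<and> (\<forall>j\<in>I. cdot (v i) (v j) = (if i = j then 1 else 0))"
using finite[of I]
proof (induction I rule: finite_induct)
  case empty
  show ?case by simp
next
  case (insert k I)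
  then obtain v d where ev: "\<And>i. i \<in> I \<Longrightarrow> A *v v i = d i *s v i"
    and on: "\<And>i j. i \<in> I \<Longrightarrow> j \<in> I \<Longrightarrow> cdot (v i) (v j) = (if i = j then 1 else 0)"
    by blast
  let ?W = "{x. \<forall>i\<in>I. cdot (v i) x = 0}"
  have inv: "A *v x \<in> ?W" if "x \<in> ?W" for x
    using that by (simp add: cdot_matrix_right normal_adjoint_eigenvector[OF assms ev] cdot_scale_left)
  obtain x where x: "x \<in> ?W" "x \<noteq> 0"
    using exists_orthogonal_vector[OF insert.hyps(2), of v] by auto
  obtain y c where y: "y \<in> ?W" "y \<noteq> 0" "A *v y = c *s y"
    by (rule invariant_subspace_eigenvector[OF _ _ inv x])
       (simp_all add: cdot_add_right cdot_scale_right)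
  define e where "e = of_real (inverse (norm y)) *s y"
  have e: "A *v e = c *s e"
    using y(3) by (simp add: e_def matrix_vector_scale vector_smult_assoc mult.commute)
  have e1: "cdot e e = 1"
    unfolding e_def cdot_scale_left cdot_scale_right unfolding cdot_self
    using y(2) by (simp add: field_simps power2_eq_square)
  have orth: "cdot (v i) e = 0" if "i \<in> I" for i
    using y(1) that by (simp add: e_def cdot_scale_right)
  have orth': "cdot e (v i) = 0" if "i \<in> I" for i
    using orth[OF that] by (simp add: cdot_commute[of e "v i"])
  have "\<forall>i\<in>insert k I. A *v (v(k := e)) i = (d(k := c)) i *s (v(k := e)) i \<and>
      (\<forall>j\<in>insert k I. cdot ((v(k := e)) i) ((v(k := e)) j) = (if i = j then 1 else 0))"
    using e e1 orth orth' ev on insert.hyps(2) by auto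
  then show ?case by blast
qed

definition diag_matrix :: "('n \<Rightarrow> 'a::zero) \<Rightarrow> 'a ^ 'n ^ 'n" where
  "diag_matrix d = (\<chi> i j. if i = j then d i else 0)"

theorem normal_matrix_unitarily_diagonalizable:
  fixes A :: "complex ^ 'n ^ 'n"
  assumes "normal_matrix A"
  obtains U d where "unitary_matrix U" "A ** U = U ** diag_matrix d"
proof -
  obtain v :: "'n \<Rightarrow> complex ^ 'n" and d where ev: "\<And>i. A *v v i = d i *s v i"
    and on: "\<And>i j. cdot (v i) (v j) = (if i = j then 1 else 0)"
    using normal_orthonormal_eigenvectors[OF assms, of UNIV] by auto
  let ?U = "(\<chi> i j. v j $ i) :: complex ^ 'n ^ 'n"
  have "adjoint_matrix ?U ** ?U = mat 1"
    using on by (simp add: vec_eq_iff matrix_matrix_mult_def adjoint_matrix_def mat_def cdot_def)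
  then have "unitary_matrix ?U"
    using matrix_left_right_inverse by (auto simp: unitary_matrix_def)
  moreover have "A ** ?U = ?U ** diag_matrix d"
  proof -
    have "(A ** ?U) $ i $ j = (?U ** diag_matrix d) $ i $ j" for i j
    proof -
      have "(A ** ?U) $ i $ j = (A *v v j) $ i"
        by (simp add: matrix_matrix_mult_def matrix_vector_mult_def)
      also have "\<dots> = (?U ** diag_matrix d) $ i $ j"
        by (simp add: ev matrix_matrix_mult_def diag_matrix_def if_distrib cong: if_cong)
      finally show ?thesis .
    qed
    then show ?thesis by (simp add: vec_eq_iff)
  qed
  ultimately show thesis by (rule that)
qed

section \<open>Eigenvalues with multiplicity\<close>

lemma map_matrix_pconst_mult:
  "map_matrix (\<lambda>a. [:a:]) (A ** B) = map_matrix (\<lambda>a. [:a:]) A ** map_matrix (\<lambda>a. [:a:]) (B :: complex ^ 'n ^ 'n)"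
proof -
  have "[:\<Sum>k\<in>K. f k * g k:] = (\<Sum>k\<in>K. [:f k:] * [:g k:])" for K :: "'n set" and f g :: "'n \<Rightarrow> complex"
  proof (induction K rule: infinite_finite_induct)
    case (insert k K)
    then show ?case
      using add_pCons[of "f k * g k" 0 "\<Sum>k\<in>K. f k * g k" 0] by (simp add: mult.commute)
  qed simp_all
  then show ?thesis
    by (simp add: vec_eq_iff matrix_matrix_mult_def)
qed

lemma matrix_diff_rdistrib: "(A - B) ** C = A ** C - B ** (C :: 'a::ring_1 ^ 'n ^ 'n)"
  and matrix_diff_ldistrib: "C ** (A - B) = C ** A - C ** (B :: 'a::ring_1 ^ 'n ^ 'n)"
  by (simp_all add: vec_eq_iff matrix_matrix_mult_def ring_distribs sum_subtractf)

text \<open>The similarity is used in the form \<open>A U = U B\<close>, lifted to matrices over polynomials.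
  Taking determinants of \<open>(X - A) U = U (X - B)\<close> leaves a common factor \<open>det U\<close>, which may be
  cancelled because the ring of polynomials is an integral domain.\<close>

lemma charpoly_similar:
  fixes A B U :: "complex ^ 'n ^ 'n"
  assumes AU: "A ** U = U ** B" and "invertible U"
  shows "charpoly A = charpoly B"
proof -
  let ?m = "map_matrix (\<lambda>a. [:a:]) :: complex ^ 'n ^ 'n \<Rightarrow> complex poly ^ 'n ^ 'n"
  let ?X = "mat [:0, 1:] :: complex poly ^ 'n ^ 'n"
  obtain V where "U ** V = mat 1"
    using assms(2) by (auto simp: invertible_def)
  then have "?m U ** ?m V = ?m (mat 1)"
    by (simp only: map_matrix_pconst_mult[symmetric])
  also have "?m (mat 1) = mat 1"
    by (simp add: vec_eq_iff mat_def)
  finally have "det (?m U) * det (?m V) = 1"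
    by (simp only: det_mul[symmetric] det_I)
  then have nz: "det (?m U) \<noteq> 0" by auto
  have "?X ** ?m U = ?m U ** ?X"
    by (simp add: vec_eq_iff matrix_matrix_mult_def mat_def if_distrib if_distribR mult.commute cong: if_cong)
  moreover have "?m A ** ?m U = ?m U ** ?m B"
    by (simp only: map_matrix_pconst_mult[symmetric] AU)
  ultimately have "(?X - ?m A) ** ?m U = ?m U ** (?X - ?m B)"
    by (simp only: matrix_diff_rdistrib matrix_diff_ldistrib)
  then have "det (?X - ?m A) * det (?m U) = det (?m U) * det (?X - ?m B)"
    by (simp only: det_mul[symmetric])
  with nz show ?thesis
    by (simp add: charpoly_def)
qed

lemma charpoly_diag_matrix: "charpoly (diag_matrix d) = (\<Prod>i\<in>UNIV. [:- d i, 1:])"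
  unfolding charpoly_def
  by (subst det_diagonal) (simp_all add: mat_def diag_matrix_def)

text \<open>Both families enumerate the multiset of roots of the same polynomial, so any sum over all
  indices agrees even though the families may differ by a permutation.\<close>

lemma sum_roots_unique:
  fixes a b :: "'n::finite \<Rightarrow> complex" and f :: "complex \<Rightarrow> 'b::comm_monoid_add"
  assumes "(\<Prod>i\<in>UNIV. [:- a i, 1:]) = (\<Prod>i\<in>UNIV. [:- b i, 1:])"
  shows "(\<Sum>i\<in>UNIV. f (a i)) = (\<Sum>i\<in>UNIV. f (b i))"
proof -
  have "(\<Sum>i\<in>UNIV. {#a i#}) = (\<Sum>i\<in>UNIV. {#b i#})"
    using arg_cong[OF assms, of proots] by (simp add: proots_prod)
  moreover have "(\<Sum>i\<in>UNIV. f (c i)) = sum_mset (image_mset f (\<Sum>i\<in>UNIV. {#c i#}))" for c :: "'n \<Rightarrow> complex"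
  proof -
    have "(\<Sum>i\<in>I. f (c i)) = sum_mset (image_mset f (\<Sum>i\<in>I. {#c i#}))" for I
      by (induction I rule: infinite_finite_induct) simp_all
    then show ?thesis .
  qed
  ultimately show ?thesis by simp
qed

section \<open>Unitary invariance of Haar-distributed vectors\<close>

lemma haar_distributed_invariant_integral:
  fixes u :: "'a \<Rightarrow> complex ^ 'n" and f :: "complex ^ 'n \<Rightarrow> 'b::{banach, second_countable_topology}"
  assumes u: "haar_distributed M u" and U: "unitary_matrix U" and f: "continuous_on UNIV f"
  shows "integral\<^sup>L M (\<lambda>\<omega>. f (U *v u \<omega>)) = integral\<^sup>L M (\<lambda>\<omega>. f (u \<omega>))"
proof -
  let ?S = "sphere_borel :: (complex ^ 'n) measure"
  let ?\<mu> = "distr M ?S u"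
  have um [measurable]: "u \<in> measurable M ?S"
    and inv: "distr ?\<mu> ?S (\<lambda>x. U *v x) = ?\<mu>"
    using u U by (auto simp: haar_distributed_def haar_sphere_measure_def)
  have "continuous_on UNIV (\<lambda>x. U *v x)"
    unfolding matrix_vector_mult_def by (intro continuous_intros)
  then have [measurable]: "(\<lambda>x. U *v x) \<in> measurable ?S ?S"
    by (intro measurable_restrict_space3 borel_measurable_continuous_onI)
       (auto simp: unitary_preserves_norm[OF U])
  have [measurable]: "f \<in> borel_measurable ?S"
    by (intro measurable_restrict_space1 borel_measurable_continuous_onI f)
  have "integral\<^sup>L M (\<lambda>\<omega>. f (U *v u \<omega>)) = integral\<^sup>L ?\<mu> (\<lambda>x. f (U *v x))"
    by (simp add: integral_distr)
  also have "\<dots> = integral\<^sup>L (distr ?\<mu> ?S (\<lambda>x. U *v x)) f"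
    by (simp add: integral_distr)
  also have "\<dots> = integral\<^sup>L M (\<lambda>\<omega>. f (u \<omega>))"
    by (simp add: inv integral_distr)
  finally show ?thesis .
qed

lemma haar_distributed_norm:
  assumes "haar_distributed M u" "\<omega> \<in> space M"
  shows "norm (u \<omega>) = 1"
proof -
  have "u \<omega> \<in> space sphere_borel"
    using assms by (auto simp: haar_distributed_def dest: measurable_space)
  then show ?thesis by (simp add: space_restrict_space)
qed

lemma haar_distributed_integrable:
  fixes u :: "'a \<Rightarrow> complex ^ 'n" and f :: "complex ^ 'n \<Rightarrow> 'b::{banach, second_countable_topology}"
  assumes M: "prob_space M" and u: "haar_distributed M u" and f: "continuous_on UNIV f"
  shows "integrable M (\<lambda>\<omega>. f (u \<omega>))"
proof -
  interpret prob_space M by fact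
  have "compact (f ` sphere 0 1)"
    by (intro compact_continuous_image continuous_on_subset[OF f]) auto
  then obtain B where B: "\<And>x. x \<in> sphere 0 1 \<Longrightarrow> norm (f x) \<le> B"
    using compact_imp_bounded by (force simp: bounded_iff)
  have [measurable]: "u \<in> measurable M sphere_borel"
    using u by (simp add: haar_distributed_def)
  have [measurable]: "f \<in> borel_measurable sphere_borel"
    by (intro measurable_restrict_space1 borel_measurable_continuous_onI f)
  show ?thesis
    by (rule integrable_const_bound[of _ B])
       (auto intro!: AE_I2 B simp: haar_distributed_norm[OF u])
qed

text \<open>The matrix \<open>[a, b; c, d]\<close> on the coordinates \<open>i\<close> and \<open>j\<close>, and the identity elsewhere. The
  entries in the rows \<open>i\<close> and \<open>j\<close> are written as sums of two indicators so that the product with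
  a vector splits into sums with a single nonzero term.\<close>

definition plane_matrix ::
    "'n \<Rightarrow> 'n \<Rightarrow> complex \<Rightarrow> complex \<Rightarrow> complex \<Rightarrow> complex \<Rightarrow> complex ^ 'n ^ 'n" where
  "plane_matrix i j a b c d = (\<chi> k l.
     if k = i then (if l = i then a else 0) + (if l = j then b else 0)
     else if k = j then (if l = i then c else 0) + (if l = j then d else 0)
     else if l = k then 1 else 0)"

lemma plane_matrix_mult_vec:
  fixes x :: "complex ^ 'n"
  shows "plane_matrix i j a b c d *v x =
    (\<chi> k. if k = i then a * x $ i + b * x $ j else if k = j then c * x $ i + d * x $ j else x $ k)"
  by (simp add: vec_eq_iff matrix_vector_mult_def plane_matrix_def distrib_right sum.distrib
      if_distrib[of "\<lambda>t. t * _"] cong: if_cong)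

lemma unitary_plane_matrix:
  fixes i j :: "'n::finite"
  assumes "i \<noteq> j" and rows: "a * cnj a + b * cnj b = 1" "c * cnj c + d * cnj d = 1" "a * cnj c + b * cnj d = 0"
  shows "unitary_matrix (plane_matrix i j a b c d)"
proof -
  let ?G = "plane_matrix i j a b c d"
  have adj: "adjoint_matrix ?G = plane_matrix i j (cnj a) (cnj c) (cnj b) (cnj d)"
    using assms(1) by (auto simp: vec_eq_iff adjoint_matrix_def plane_matrix_def)
  have "c * cnj a + d * cnj b = cnj (a * cnj c + b * cnj d)"
    by (simp add: mult.commute)
  then have rows': "c * cnj a + d * cnj b = 0"
    using rows(3) by simp
  have "(?G ** adjoint_matrix ?G) *v x = mat 1 *v x" for x
  proof -
    have "a * (cnj a * x $ i + cnj c * x $ j) + b * (cnj b * x $ i + cnj d * x $ j)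
        = (a * cnj a + b * cnj b) * x $ i + (a * cnj c + b * cnj d) * x $ j"
      "c * (cnj a * x $ i + cnj c * x $ j) + d * (cnj b * x $ i + cnj d * x $ j)
        = (c * cnj a + d * cnj b) * x $ i + (c * cnj c + d * cnj d) * x $ j"
      by (simp_all add: algebra_simps)
    then show ?thesis
      using assms(1) rows rows'
      by (simp add: adj vec_eq_iff matrix_vector_mul_assoc[symmetric] plane_matrix_mult_vec)
  qed
  then have "?G ** adjoint_matrix ?G = mat 1"
    by (simp add: matrix_eq)
  then show ?thesis
    using matrix_left_right_inverse by (auto simp: unitary_matrix_def)
qed

section \<open>Joint moments of the squared moduli of the coordinates\<close>

lemma unit_sphere_sum_coords:
  fixes x :: "complex ^ 'n"
  assumes "norm x = 1"
  shows "(\<Sum>i\<in>UNIV. (cmod (x $ i))\<^sup>2) = 1"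
  using assms by (simp add: norm_vec_def L2_set_def)

lemma haar_expectation_coord_exchange:
  fixes u :: "'a \<Rightarrow> complex ^ 'n"
  assumes u: "haar_distributed M u" and g: "continuous_on UNIV g"
  shows "integral\<^sup>L M (\<lambda>\<omega>. g (u \<omega> $ i)) = (integral\<^sup>L M (\<lambda>\<omega>. g (u \<omega> $ j)) :: real)"
proof (cases "i = j")
  case False
  have "continuous_on UNIV (\<lambda>x :: complex ^ 'n. g (x $ i))"
    by (intro continuous_on_compose2[OF g] continuous_intros) auto
  from haar_distributed_invariant_integral[OF u unitary_plane_matrix this, of i j 0 1 1 0] False
  show ?thesis by (simp add: plane_matrix_mult_vec)
qed simp

lemma haar_expectation_coord:
  fixes u :: "'a \<Rightarrow> complex ^ 'n"
  assumes M: "prob_space M" and u: "haar_distributed M u"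
  shows "integral\<^sup>L M (\<lambda>\<omega>. (cmod (u \<omega> $ i))\<^sup>2) = 1 / real CARD('n)"
proof -
  interpret prob_space M by fact
  have int: "integrable M (\<lambda>\<omega>. (cmod (u \<omega> $ j))\<^sup>2)" for j
    by (rule haar_distributed_integrable[OF M u]) (intro continuous_intros)
  have "(\<Sum>j\<in>UNIV. integral\<^sup>L M (\<lambda>\<omega>. (cmod (u \<omega> $ j))\<^sup>2)) = integral\<^sup>L M (\<lambda>\<omega>. \<Sum>j\<in>UNIV. (cmod (u \<omega> $ j))\<^sup>2)"
    by (simp add: int)
  also have "\<dots> = integral\<^sup>L M (\<lambda>_. 1)"
    by (intro Bochner_Integration.integral_cong refl) (simp add: unit_sphere_sum_coords haar_distributed_norm[OF u])
  also have "\<dots> = 1" by (simp add: prob_space)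
  finally have "(\<Sum>j\<in>UNIV. integral\<^sup>L M (\<lambda>\<omega>. (cmod (u \<omega> $ j))\<^sup>2)) = 1" .
  moreover have "(\<Sum>j\<in>UNIV. integral\<^sup>L M (\<lambda>\<omega>. (cmod (u \<omega> $ j))\<^sup>2))
      = (\<Sum>j\<in>(UNIV :: 'n set). integral\<^sup>L M (\<lambda>\<omega>. (cmod (u \<omega> $ i))\<^sup>2))"
    by (intro sum.cong refl haar_expectation_coord_exchange[OF u]) (intro continuous_intros)
  ultimately show ?thesis by (simp add: field_simps)
qed

text \<open>The first row of the unitary matrix
  \<open>[(1 + \<i>)/2, (1 - \<i>)/2; (1 - \<i>)/2, (1 + \<i>)/2]\<close>; exchanging \<open>a\<close> and \<open>b\<close> gives the second row
  and flips the sign of the cross term.\<close>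

lemma cmod_balanced_mix:
  "(cmod ((1 + \<i>) / 2 * a + (1 - \<i>) / 2 * b))\<^sup>2 = ((cmod a)\<^sup>2 + (cmod b)\<^sup>2) / 2 - Im (a * cnj b)"
proof -
  have "(1 + \<i>) / 2 * a + (1 - \<i>) / 2 * b
      = Complex ((Re a - Im a + Re b + Im b) / 2) ((Re a + Im a - Re b + Im b) / 2)"
    by (simp add: complex_eq_iff algebra_simps add_divide_distrib diff_divide_distrib)
  then show ?thesis
    by (simp only: cmod_power2) (simp add: field_simps power2_eq_square)
qed

text \<open>Put \<open>w = u\<^sub>i cnj(u\<^sub>j)\<close>, \<open>\<alpha> = E |u\<^sub>i|\<^sup>4\<close> and \<open>\<beta> = E |u\<^sub>i|\<^sup>2 |u\<^sub>j|\<^sup>2 = E |w|\<^sup>2\<close>. Multiplying \<open>u\<^sub>j\<close> by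
  \<open>\<i>\<close> exchanges \<open>(Re w)\<^sup>2\<close> and \<open>(Im w)\<^sup>2\<close>, so each has expectation \<open>\<beta> / 2\<close>. The balanced mixing
  turns \<open>|u\<^sub>i|\<^sup>2 |u\<^sub>j|\<^sup>2\<close> into \<open>((|u\<^sub>i|\<^sup>2 + |u\<^sub>j|\<^sup>2) / 2)\<^sup>2 - (Im w)\<^sup>2\<close>, so
  \<open>\<beta> = (\<alpha> + \<beta>) / 2 - \<beta> / 2\<close>, that is \<open>\<alpha> = 2 \<beta>\<close>.\<close>

lemma haar_expectation_coord_product:
  fixes u :: "'a \<Rightarrow> complex ^ 'n"
  assumes M: "prob_space M" and u: "haar_distributed M u" and ij: "i \<noteq> j"
  shows "integral\<^sup>L M (\<lambda>\<omega>. (cmod (u \<omega> $ i))\<^sup>2 * (cmod (u \<omega> $ j))\<^sup>2)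
    = integral\<^sup>L M (\<lambda>\<omega>. (cmod (u \<omega> $ i)) ^ 4) / 2"
proof -
  define p :: "'n \<Rightarrow> complex ^ 'n \<Rightarrow> real" where "p k x = (cmod (x $ k))\<^sup>2" for k x
  define R where "R x = Re (x $ i * cnj (x $ j))" for x :: "complex ^ 'n"
  define S where "S x = Im (x $ i * cnj (x $ j))" for x :: "complex ^ 'n"
  define E :: "(complex ^ 'n \<Rightarrow> real) \<Rightarrow> real" where "E f = integral\<^sup>L M (\<lambda>\<omega>. f (u \<omega>))" for f
  have cont: "continuous_on UNIV (p k)" "continuous_on UNIV R" "continuous_on UNIV S" for k
    unfolding p_def[abs_def] R_def[abs_def] S_def[abs_def] by (intro continuous_intros)+
  have int: "integrable M (\<lambda>\<omega>. f (u \<omega>))" if "continuous_on UNIV f" for f :: "complex ^ 'n \<Rightarrow> real"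
    by (rule haar_distributed_integrable[OF M u that])
  have inv: "E (\<lambda>x. f (U *v x)) = E f" if "unitary_matrix U" "continuous_on UNIV f" for U f
    unfolding E_def by (rule haar_distributed_invariant_integral[OF u that])
  have RS: "(R x)\<^sup>2 + (S x)\<^sup>2 = p i x * p j x" for x
    by (simp add: R_def S_def p_def cmod_def algebra_simps power2_eq_square)
  have "E (\<lambda>x. (R x)\<^sup>2) = E (\<lambda>x. (S x)\<^sup>2)"
  proof -
    let ?U = "plane_matrix i j 1 0 0 \<i> :: complex ^ 'n ^ 'n"
    have "S (?U *v x) = - R x" for x
      using ij by (simp add: plane_matrix_mult_vec R_def S_def)
    then show ?thesis
      using inv[of ?U "\<lambda>x. (S x)\<^sup>2"] unitary_plane_matrix[OF ij, of 1 0 0 \<i>]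
      by (simp add: cont continuous_intros)
  qed
  moreover have "E (\<lambda>x. (R x)\<^sup>2) + E (\<lambda>x. (S x)\<^sup>2) = E (\<lambda>x. p i x * p j x)"
    unfolding E_def RS[symmetric]
    by (rule Bochner_Integration.integral_add[symmetric]) (intro int continuous_intros cont)+
  moreover have "E (\<lambda>x. p i x * p j x) = (E (\<lambda>x. (p i x)\<^sup>2) + E (\<lambda>x. (p j x)\<^sup>2) + 2 * E (\<lambda>x. p i x * p j x)) / 4 - E (\<lambda>x. (S x)\<^sup>2)"
  proof -
    let ?U = "plane_matrix i j ((1 + \<i>) / 2) ((1 - \<i>) / 2) ((1 - \<i>) / 2) ((1 + \<i>) / 2) :: complex ^ 'n ^ 'n"
    have pU: "p i (?U *v x) = (p i x + p j x) / 2 - S x" "p j (?U *v x) = (p i x + p j x) / 2 + S x" for x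
      using ij cmod_balanced_mix[of "x $ i" "x $ j"] cmod_balanced_mix[of "x $ j" "x $ i"]
      by (simp_all add: plane_matrix_mult_vec p_def S_def add.commute mult.commute)
    have "p i (?U *v x) * p j (?U *v x)
        = ((p i x)\<^sup>2 + (p j x)\<^sup>2 + 2 * (p i x * p j x)) / 4 - (S x)\<^sup>2" for x
      unfolding pU by (simp add: field_simps power2_eq_square)
    moreover have "unitary_matrix ?U"
      using ij by (intro unitary_plane_matrix) (simp_all add: complex_eq_iff)
    ultimately have "E (\<lambda>x. p i x * p j x) = E (\<lambda>x. ((p i x)\<^sup>2 + (p j x)\<^sup>2 + 2 * (p i x * p j x)) / 4 - (S x)\<^sup>2)"
      using inv[of ?U "\<lambda>x. p i x * p j x"] by (simp add: cont continuous_intros)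
    also have "\<dots> = (E (\<lambda>x. (p i x)\<^sup>2) + E (\<lambda>x. (p j x)\<^sup>2) + 2 * E (\<lambda>x. p i x * p j x)) / 4 - E (\<lambda>x. (S x)\<^sup>2)"
    proof -
      have "integrable M (\<lambda>\<omega>. (p k (u \<omega>))\<^sup>2)" "integrable M (\<lambda>\<omega>. (S (u \<omega>))\<^sup>2)"
        "integrable M (\<lambda>\<omega>. p i (u \<omega>) * p j (u \<omega>))" for k
        by (rule int, intro continuous_intros cont)+
      then show ?thesis
        unfolding E_def by simp
    qed
    finally show ?thesis .
  qed
  moreover have "E (\<lambda>x. (p j x)\<^sup>2) = E (\<lambda>x. (p i x)\<^sup>2)"
    unfolding E_def p_def by (rule haar_expectation_coord_exchange[OF u]) (intro continuous_intros)
  moreover have "\<beta> = \<alpha> / 2" if "r = s" "r + s = \<beta>" "\<beta> = (\<alpha> + \<alpha>' + 2 * \<beta>) / 4 - s" "\<alpha>' = \<alpha>"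
    for r s \<alpha> \<alpha>' \<beta> :: real
    using that by (simp add: field_simps)
  ultimately have "E (\<lambda>x. p i x * p j x) = E (\<lambda>x. (p i x)\<^sup>2) / 2"
    by blast
  then show ?thesis
    by (simp add: E_def p_def power_mult[symmetric])
qed

text \<open>Writing the moments as \<open>(1 + \<delta>\<^sub>k\<^sub>l) * a / 2\<close>, where \<open>a\<close> is the common value on the diagonal,
  leaves a single unknown. It is found by integrating the square of \<open>\<Sum>k. |u\<^sub>k|\<^sup>2 = 1\<close>.\<close>

lemma haar_expectation_coord_products:
  fixes u :: "'a \<Rightarrow> complex ^ 'n"
  assumes M: "prob_space M" and u: "haar_distributed M u"
  shows "integral\<^sup>L M (\<lambda>\<omega>. (cmod (u \<omega> $ i))\<^sup>2 * (cmod (u \<omega> $ j))\<^sup>2)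
    = (if i = j then 2 else 1) / (real CARD('n) * (real CARD('n) + 1))"
proof -
  interpret prob_space M by fact
  define q :: "'n \<Rightarrow> 'n \<Rightarrow> real" where
    "q k l = integral\<^sup>L M (\<lambda>\<omega>. (cmod (u \<omega> $ k))\<^sup>2 * (cmod (u \<omega> $ l))\<^sup>2)" for k l
  define a where "a = q i i"
  have int: "integrable M (\<lambda>\<omega>. (cmod (u \<omega> $ k))\<^sup>2 * (cmod (u \<omega> $ l))\<^sup>2)" for k l
    by (rule haar_distributed_integrable[OF M u, of "\<lambda>x. (cmod (x $ k))\<^sup>2 * (cmod (x $ l))\<^sup>2"])
       (intro continuous_intros)
  have diag: "q k k = a" for k
    unfolding a_def q_def
    by (rule haar_expectation_coord_exchange[OF u, of "\<lambda>z. (cmod z)\<^sup>2 * (cmod z)\<^sup>2"]) (intro continuous_intros)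
  have q: "q k l = (if l = k then a / 2 else 0) + a / 2" for k l
  proof (cases "l = k")
    case False
    then have "q k l = q k k / 2"
      using haar_expectation_coord_product[OF M u, of k l]
      by (simp add: q_def power2_eq_square power4_eq_xxxx mult.assoc)
    with False diag show ?thesis by simp
  qed (simp add: diag)
  have "(\<Sum>k\<in>UNIV. \<Sum>l\<in>UNIV. q k l)
      = integral\<^sup>L M (\<lambda>\<omega>. (\<Sum>k\<in>UNIV. (cmod (u \<omega> $ k))\<^sup>2) * (\<Sum>l\<in>UNIV. (cmod (u \<omega> $ l))\<^sup>2))"
    by (simp add: q_def int sum_product)
  also have "\<dots> = integral\<^sup>L M (\<lambda>_. 1)"
    by (intro Bochner_Integration.integral_cong refl) (simp add: unit_sphere_sum_coords haar_distributed_norm[OF u])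
  also have "\<dots> = 1" by (simp add: prob_space)
  finally have "real CARD('n) * (real CARD('n) + 1) * (a / 2) = 1"
    by (simp add: q sum.distrib algebra_simps)
  then have "a / 2 = 1 / (real CARD('n) * (real CARD('n) + 1))"
    by (simp add: field_simps add_nonneg_eq_0_iff)
  then show ?thesis
    using q[of i j] by (auto simp: q_def)
qed

section \<open>The quadratic form of a normal matrix\<close>

text \<open>In the second moment the terms with equal indices count twice, once in the constant
  part, which contributes \<open>|\<Sum>i. c i|\<^sup>2 = 0\<close>, and once on their own.\<close>

lemma haar_weighted_coords:
  fixes u :: "'a \<Rightarrow> complex ^ 'n" and c :: "'n \<Rightarrow> complex"
  assumes M: "prob_space M" and u: "haar_distributed M u"
  shows "integral\<^sup>L M (\<lambda>\<omega>. \<Sum>i\<in>UNIV. c i * of_real ((cmod (u \<omega> $ i))\<^sup>2)) = (\<Sum>i\<in>UNIV. c i) / of_nat CARD('n)"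
    and "(\<Sum>i\<in>UNIV. c i) = 0 \<Longrightarrow>
      integral\<^sup>L M (\<lambda>\<omega>. (cmod (\<Sum>i\<in>UNIV. c i * of_real ((cmod (u \<omega> $ i))\<^sup>2)))\<^sup>2)
        = (\<Sum>i\<in>UNIV. (cmod (c i))\<^sup>2) / (real CARD('n) * (real CARD('n) + 1))"
proof -
  have int1: "integrable M (\<lambda>\<omega>. (cmod (u \<omega> $ i))\<^sup>2)" for i
    by (rule haar_distributed_integrable[OF M u]) (intro continuous_intros)
  have int2: "integrable M (\<lambda>\<omega>. (cmod (u \<omega> $ i))\<^sup>2 * (cmod (u \<omega> $ j))\<^sup>2)" for i j
    by (rule haar_distributed_integrable[OF M u, of "\<lambda>x. (cmod (x $ i))\<^sup>2 * (cmod (x $ j))\<^sup>2"])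
       (intro continuous_intros)
  show "integral\<^sup>L M (\<lambda>\<omega>. \<Sum>i\<in>UNIV. c i * of_real ((cmod (u \<omega> $ i))\<^sup>2)) = (\<Sum>i\<in>UNIV. c i) / of_nat CARD('n)"
    by (simp add: int1 haar_expectation_coord[OF M u] sum_divide_distrib del: of_real_power)
  assume c0: "(\<Sum>i\<in>UNIV. c i) = 0"
  let ?K = "real CARD('n) * (real CARD('n) + 1)"
  have expand: "(cmod (\<Sum>i\<in>UNIV. c i * of_real (p i)))\<^sup>2 =
      (\<Sum>i\<in>UNIV. \<Sum>j\<in>UNIV. Re (c i * cnj (c j)) * (p i * p j))" for p :: "'n \<Rightarrow> real"
  proof -
    have "complex_of_real ((cmod (\<Sum>i\<in>UNIV. c i * of_real (p i)))\<^sup>2)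
      = (\<Sum>i\<in>UNIV. \<Sum>j\<in>UNIV. (c i * cnj (c j)) * of_real (p i * p j))"
      unfolding complex_norm_square by (simp add: sum_product mult_ac)
    from arg_cong[OF this, of Re] show ?thesis by simp
  qed
  have "integral\<^sup>L M (\<lambda>\<omega>. (cmod (\<Sum>i\<in>UNIV. c i * of_real ((cmod (u \<omega> $ i))\<^sup>2)))\<^sup>2)
     = (\<Sum>i\<in>UNIV. \<Sum>j\<in>UNIV. Re (c i * cnj (c j)) * ((if i = j then 2 else 1) / ?K))"
    unfolding expand by (simp add: int2 haar_expectation_coord_products[OF M u] del: of_real_power)
  also have "\<dots> = (\<Sum>i\<in>UNIV. \<Sum>j\<in>UNIV. (Re (c i * cnj (c j)) + (if j = i then (cmod (c i))\<^sup>2 else 0)) / ?K)"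
    by (intro sum.cong refl) (simp add: cmod_def power2_eq_square)
  also have "\<dots> = ((\<Sum>i\<in>UNIV. \<Sum>j\<in>UNIV. Re (c i * cnj (c j))) + (\<Sum>i\<in>UNIV. (cmod (c i))\<^sup>2)) / ?K"
    by (simp add: sum_divide_distrib[symmetric] sum.distrib)
  also have "(\<Sum>i\<in>UNIV. \<Sum>j\<in>UNIV. Re (c i * cnj (c j))) = 0"
    using expand[of "\<lambda>_. 1"] c0 by simp
  finally show "integral\<^sup>L M (\<lambda>\<omega>. (cmod (\<Sum>i\<in>UNIV. c i * of_real ((cmod (u \<omega> $ i))\<^sup>2)))\<^sup>2)
     = (\<Sum>i\<in>UNIV. (cmod (c i))\<^sup>2) / ?K" by simp
qed

lemma zform_unitary_diagonal:
  assumes U: "unitary_matrix U" and AU: "A ** U = U ** diag_matrix d"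
  shows "zform A (U *v x) = (\<Sum>i\<in>UNIV. d i * of_real ((cmod (x $ i))\<^sup>2))"
proof -
  have "zform A (U *v x) = cdot (U *v x) (U *v (diag_matrix d *v x))"
    by (simp add: zform_def cdot_def matrix_vector_mul_assoc AU)
  also have "\<dots> = cdot x (diag_matrix d *v x)"
    using U by (simp add: cdot_matrix_left matrix_vector_mul_assoc matrix_mul_assoc unitary_matrix_def)
  also have "diag_matrix d *v x = (\<chi> i. d i * x $ i)"
    by (simp add: vec_eq_iff diag_matrix_def matrix_vector_mult_def if_distrib[of "\<lambda>t. t * _"] cong: if_cong)
  finally show ?thesis
    by (simp add: cdot_def complex_norm_square mult_ac del: of_real_power)
qed

theorem proposition7p1:
  fixes A :: "complex ^ 'n ^ 'n" and eig :: "'n \<Rightarrow> complex"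
    and M :: "'a measure" and u :: "'a \<Rightarrow> complex ^ 'n"
  assumes "normal_matrix A"
    and "eigenvalue_list A eig"
    and "prob_space M"
    and "haar_distributed M u"
  shows "integrable M (\<lambda>\<omega>. zform A (u \<omega>))
    \<and> integral\<^sup>L M (\<lambda>\<omega>. zform A (u \<omega>)) = eigenvalue_mean eig
    \<and> integrable M (\<lambda>\<omega>. (cmod (zform A (u \<omega>) - eigenvalue_mean eig))\<^sup>2)
    \<and> integral\<^sup>L M (\<lambda>\<omega>. (cmod (zform A (u \<omega>) - eigenvalue_mean eig))\<^sup>2)
        = 1 / (real CARD('n) + 1)
          * (1 / real CARD('n) * (\<Sum>i\<in>UNIV. (cmod (eig i - eigenvalue_mean eig))\<^sup>2))
    \<and> (\<forall>s r :: real.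
          s\<^sup>2 = 1 / real CARD('n) * (\<Sum>i\<in>UNIV. (cmod (eig i - eigenvalue_mean eig))\<^sup>2)
          \<longrightarrow> r > 0
          \<longrightarrow> measure M {\<omega> \<in> space M. cmod (zform A (u \<omega>) - eigenvalue_mean eig) \<ge> r}
              \<le> s\<^sup>2 / ((real CARD('n) + 1) * r\<^sup>2))"
proof -
  note M = assms(3) and u = assms(4)
  let ?m = "eigenvalue_mean eig"
  let ?N = "real CARD('n)"
  let ?V = "\<Sum>i\<in>UNIV. (cmod (eig i - ?m))\<^sup>2"
  let ?Z = "\<lambda>\<omega>. (cmod (zform A (u \<omega>) - ?m))\<^sup>2"
  obtain U d where U: "unitary_matrix U" and AU: "A ** U = U ** diag_matrix d"
    using normal_matrix_unitarily_diagonalizable[OF assms(1)] .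
  have "invertible U"
    using U by (auto simp: unitary_matrix_def invertible_def)
  then have roots: "(\<Prod>i\<in>UNIV. [:- eig i, 1:]) = (\<Prod>i\<in>UNIV. [:- d i, 1:])"
    using charpoly_similar[OF AU] assms(2) by (simp add: eigenvalue_list_def charpoly_diag_matrix)
  note transfer = sum_roots_unique[OF roots]
  \<comment> \<open>The mean of \<open>eig\<close> is also the mean of \<open>d\<close>, so the centred weights \<open>d i - ?m\<close> sum to zero.\<close>
  have mean: "?m = (\<Sum>i\<in>UNIV. d i) / of_nat CARD('n)"
    using transfer[of "\<lambda>z. z"] by (simp add: eigenvalue_mean_def)
  have zcont: "continuous_on UNIV (zform A)"
    unfolding zform_def[abs_def] matrix_vector_mult_def by (intro continuous_intros)
  have i1: "integrable M (\<lambda>\<omega>. zform A (u \<omega>))"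
    by (rule haar_distributed_integrable[OF M u zcont])
  have i2: "integrable M ?Z"
    by (rule haar_distributed_integrable[OF M u]) (intro continuous_intros zcont)
  have e1: "integral\<^sup>L M (\<lambda>\<omega>. zform A (u \<omega>)) = ?m"
    using haar_distributed_invariant_integral[OF u U zcont] haar_weighted_coords(1)[OF M u, of d]
    by (simp add: zform_unitary_diagonal[OF U AU] mean)
  have "integral\<^sup>L M ?Z = integral\<^sup>L M (\<lambda>\<omega>. (cmod (zform A (U *v u \<omega>) - ?m))\<^sup>2)"
    by (rule haar_distributed_invariant_integral[OF u U, symmetric]) (intro continuous_intros zcont)
  also have "\<dots> = integral\<^sup>L M (\<lambda>\<omega>. (cmod (\<Sum>i\<in>UNIV. (d i - ?m) * of_real ((cmod (u \<omega> $ i))\<^sup>2)))\<^sup>2)"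
  proof (intro Bochner_Integration.integral_cong refl)
    fix \<omega> assume "\<omega> \<in> space M"
    then have "(\<Sum>i\<in>UNIV. (cmod (u \<omega> $ i))\<^sup>2) = 1"
      by (simp add: unit_sphere_sum_coords haar_distributed_norm[OF u])
    \<comment> \<open>On the unit sphere the constant \<open>?m\<close> is itself a weighted sum of the squared moduli.\<close>
    then have "?m = (\<Sum>i\<in>UNIV. ?m * of_real ((cmod (u \<omega> $ i))\<^sup>2))"
      by (simp flip: sum_distrib_left of_real_sum of_real_power)
    then show "(cmod (zform A (U *v u \<omega>) - ?m))\<^sup>2 = (cmod (\<Sum>i\<in>UNIV. (d i - ?m) * of_real ((cmod (u \<omega> $ i))\<^sup>2)))\<^sup>2"
      by (simp add: zform_unitary_diagonal[OF U AU] left_diff_distrib sum_subtractf del: of_real_power)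
  qed
  also have "\<dots> = (\<Sum>i\<in>UNIV. (cmod (d i - ?m))\<^sup>2) / (?N * (?N + 1))"
    by (rule haar_weighted_coords(2)[OF M u]) (simp add: sum_subtractf mean)
  also have "(\<Sum>i\<in>UNIV. (cmod (d i - ?m))\<^sup>2) = ?V"
    using transfer[of "\<lambda>z. (cmod (z - ?m))\<^sup>2"] by simp
  finally have e2: "integral\<^sup>L M ?Z = 1 / (?N + 1) * (1 / ?N * ?V)"
    by (simp add: mult.commute)
  have "measure M {\<omega> \<in> space M. cmod (zform A (u \<omega>) - ?m) \<ge> r} \<le> s\<^sup>2 / ((?N + 1) * r\<^sup>2)"
    if s: "s\<^sup>2 = 1 / ?N * ?V" and r: "r > 0" for s r
  proof -
    have "{\<omega> \<in> space M. cmod (zform A (u \<omega>) - ?m) \<ge> r} = {\<omega> \<in> space M. ?Z \<omega> \<ge> r\<^sup>2}"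
      using r by (auto simp: abs_le_square_iff[symmetric])
    also have "measure M \<dots> \<le> integral\<^sup>L M ?Z / r\<^sup>2"
      by (rule integral_Markov_inequality_measure[OF i2 sets.top]) (use r in auto)
    also have "\<dots> = s\<^sup>2 / ((?N + 1) * r\<^sup>2)"
      unfolding e2 s[symmetric] by simp
    finally show ?thesis .
  qed
  with i1 e1 i2 e2 show ?thesis by blast
qed

end
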